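(* Let $X$ be a simplicial complex, let $1\le r\le \dim(X)$, and let $k$ be an integer with $1\le k\le f_{r-1}(X)/(r+1)$. Then \[ \sum_{i=1}^k \lambda_i(L_{r-1}^{+}(X))\le \sum_{i=1}^{(r+1)k} d^{(r)}_i(X). \]
   Context: A simplicial complex $X$ on a finite vertex set $V$ is a family of subsets of $V$ closed under inclusion; its elements are called simplices (or faces), $\dim(\sigma)=|\sigma|-1$ for $\sigma\in X$, and $\dim(X)$ is the maximal dimension of a simplex. $X(i)$ is the set of $i$-dimensional simplices (with $X(-1)=\{\emptyset\}$) and $f_i(X)=|X(i)|$. For $\sigma\in X$ and $1\le r\le\dim(X)$, the $r$-degree $\deg_X^{(r)}(\sigma)$ is the number of $r$-dimensional simplices of $X$ containing $\sigma$. For $1\le i\le f_{r-1}(X)$, $d_i^{(r)}(X)$ is the $i$-th largest (with multiplicity) $r$-degree of a simplex in $X(r-1)$. Fix an arbitrary linear order $<$ on $V$. For $\sigma\in X(s-1)$, $\tau\in X(s)$ with $\sigma\subset\tau$ ($0\le s\le \dim(X)$), let $u$ be the unique vertex of $\tau\setminus\sigma$ and set $(\tau:\sigma)=(-1)^{|\{v\in\tau:\,v<u\}|}$. For $1\le r\le\dim(X)$, the upper Laplacian $L_{r-1}^+(X)\in\mathbb{R}^{f_{r-1}(X)\times f_{r-1}(X)}$ is the matrix indexed by $X(r-1)$ with $L_{r-1}^+(X)_{\tau,\tau}=\deg_X^{(r)}(\tau)$; $L_{r-1}^+(X)_{\tau,\eta}=-(\tau:\tau\cap\eta)(\eta:\tau\cap\eta)$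 if $|\tau\cap\eta|=r-1$ and $\tau\cup\eta\in X$; and all other entries $0$. For a symmetric real matrix $M$, $\lambda_i(M)$ is its $i$-th largest eigenvalue (with multiplicity). *)

theory Defs
  imports "Jordan_Normal_Form.Char_Poly"
begin

(* The empty face is required, so the void family is excluded and cdim below is a
   maximum over a nonempty set.  Not every element of V has to be a vertex of X. *)
definition simplicial_complex :: "'a set \<Rightarrow> 'a set set \<Rightarrow> bool" where
  "simplicial_complex V X \<longleftrightarrow>
     finite V \<and> X \<subseteq> Pow V \<and> {} \<in> X \<and> (\<forall>\<tau>\<in>X. \<forall>\<sigma>. \<sigma> \<subseteq> \<tau> \<longrightarrow> \<sigma> \<in> X)"

definition sdim :: "'a set \<Rightarrow> int" where
  "sdim \<sigma> = int (card \<sigma>) - 1"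

definition cdim :: "'a set set \<Rightarrow> int" where
  "cdim X = Max (sdim ` X)"

definition simplices :: "'a set set \<Rightarrow> int \<Rightarrow> 'a set set" where
  "simplices X i = {\<sigma> \<in> X. sdim \<sigma> = i}"

definition face_number :: "'a set set \<Rightarrow> int \<Rightarrow> nat" where
  "face_number X i = card (simplices X i)"

definition r_degree :: "'a set set \<Rightarrow> nat \<Rightarrow> 'a set \<Rightarrow> nat" where
  "r_degree X r \<sigma> = card {\<tau> \<in> simplices X (int r). \<sigma> \<subseteq> \<tau>}"

(* Positions are counted from 1; only meaningful for 1 \<le> i \<le> size A. *)
definition ith_largest :: "'b::linorder multiset \<Rightarrow> nat \<Rightarrow> 'b" where
  "ith_largest A i = rev (sorted_list_of_multiset A) ! (i - 1)"

definition ith_degree :: "'a set set \<Rightarrow> nat \<Rightarrow> nat \<Rightarrow> nat" where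
  "ith_degree X r i =
     ith_largest (image_mset (r_degree X r) (mset_set (simplices X (int r - 1)))) i"

(* The incidence sign (\<tau> : \<sigma>), for R a (reflexive) linear order on the vertices and
   \<tau> obtained from \<sigma> by adding one vertex u. *)
definition incidence :: "('a \<times> 'a) set \<Rightarrow> 'a set \<Rightarrow> 'a set \<Rightarrow> real" where
  "incidence R \<tau> \<sigma> =
     (let u = (THE u. u \<in> \<tau> - \<sigma>) in (-1) ^ card {v \<in> \<tau>. (v, u) \<in> R \<and> v \<noteq> u})"

definition upper_laplacian ::
  "('a \<times> 'a) set \<Rightarrow> 'a set set \<Rightarrow> nat \<Rightarrow> 'a set \<Rightarrow> 'a set \<Rightarrow> real" where
  "upper_laplacian R X r \<tau> \<eta> =
     (if \<tau> = \<eta> then real (r_degree X r \<tau>)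
      else if int (card (\<tau> \<inter> \<eta>)) = int r - 1 \<and> \<tau> \<union> \<eta> \<in> X
        then - incidence R \<tau> (\<tau> \<inter> \<eta>) * incidence R \<eta> (\<tau> \<inter> \<eta>)
      else 0)"

(* Matrices of this library have rows and columns numbered from 0, so an index set is
   presented by a list fs enumerating it without repetition. *)
definition indexed_mat :: "'b list \<Rightarrow> ('b \<Rightarrow> 'b \<Rightarrow> real) \<Rightarrow> real mat" where
  "indexed_mat fs M = mat (length fs) (length fs) (\<lambda>(i, j). M (fs ! i) (fs ! j))"

(* Eigenvalues with multiplicity are the real roots of the characteristic polynomial;
   for a symmetric matrix these are all of its roots. *)
definition ith_eigenvalue :: "real mat \<Rightarrow> nat \<Rightarrow> real" where
  "ith_eigenvalue M i = ith_largest (proots (char_poly M)) i"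

end

theory Submission
  imports Defs "HOL-Analysis.Convex" "Jordan_Normal_Form.Schur_Decomposition"
begin

text \<open>
  The upper Laplacian factors as \<open>B B\<^sup>T\<close>, where \<open>B\<close> is the signed incidence matrix between
  \<open>(r - 1)\<close>- and \<open>r\<close>-simplices. Let \<open>x\<^sub>1, \<dots>, x\<^sub>k\<close> be orthonormal eigenvectors for the \<open>k\<close> largest
  eigenvalues and put \<open>z\<^sub>i = B\<^sup>T x\<^sub>i\<close>; these are orthogonal with \<open>|z\<^sub>i|\<^sup>2 = \<lambda>\<^sub>i\<close>, and
  \<open>\<lambda>\<^sub>i x\<^sub>i(\<tau>)\<close> is the inner product of \<open>z\<^sub>i\<close> with the row \<open>B\<^sub>\<tau>\<close>, whose squared norm is \<open>deg \<tau>\<close>.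
  Bessel's inequality bounds \<open>\<Sum>\<^sub>i \<lambda>\<^sub>i x\<^sub>i(\<tau>)\<^sup>2\<close> by \<open>deg \<tau>\<close>, and the Cauchy-Schwarz inequality bounds
  it by \<open>deg \<tau>\<close> times the sum of \<open>q(\<sigma>) = \<Sum>\<^sub>i z\<^sub>i(\<sigma>)\<^sup>2 / \<lambda>\<^sub>i\<close> over the \<open>r\<close>-simplices \<open>\<sigma>\<close> containing \<open>\<tau>\<close>.
  So \<open>\<Sum>\<^sub>i \<lambda>\<^sub>i \<le> \<Sum>\<^sub>\<tau> w(\<tau>) deg \<tau>\<close> for weights \<open>w\<close> in \<open>[0, 1]\<close>, and the total weight is at most
  \<open>(r + 1) k\<close>, because \<open>q\<close> has total mass at most \<open>k\<close> and each \<open>\<sigma>\<close> has \<open>r + 1\<close> facets. Such a weighted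
  sum is largest when the weight sits on the \<open>(r + 1) k\<close> simplices of largest degree.
\<close>

subsection \<open>Weighted sums\<close>

text \<open>Measure \<open>d\<close> relative to its \<open>m\<close>-th largest value
  \<open>c\<close>. Weight 1 is best where \<open>d\<close> exceeds \<open>c\<close> and weight 0
  where it falls below, and the remaining term \<open>c * sum w T\<close> is at most
  \<open>c * m\<close>.\<close>

lemma sum_mult_le_sum_ith_largest:
  fixes d :: "'b \<Rightarrow> nat" and w :: "'b \<Rightarrow> real"
  assumes T: "finite T"
    and w: "\<And>t. t \<in> T \<Longrightarrow> 0 \<le> w t" "\<And>t. t \<in> T \<Longrightarrow> w t \<le> 1"
    and sum_w: "sum w T \<le> real m" and m: "m \<le> card T"
  shows "(\<Sum>t\<in>T. real (d t) * w t)
           \<le> (\<Sum>i = 1..m. real (ith_largest (image_mset d (mset_set T)) i))"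
proof (cases "m = 0")
  case True
  \<comment> \<open>With \<open>m = 0\<close> there is no \<open>m\<close>-th largest value to serve
    as the threshold \<open>c\<close>, so this case is separate.\<close>
  then have "sum w T = 0"
    using sum_w w(1) by (simp add: antisym sum_nonneg)
  then have "\<forall>t\<in>T. w t = 0"
    using T w(1) by (simp add: sum_nonneg_eq_0_iff)
  then show ?thesis
    by (simp add: True)
next
  case False
  obtain us where us: "set us = T" "distinct us"
    using T finite_distinct_list by blast
  \<comment> \<open>\<open>ts\<close> lists \<open>T\<close> by decreasing \<open>d\<close>. Mapping
    \<open>d\<close> over it gives the list that \<open>ith_largest\<close> indexes, however ties
    are ordered.\<close>
  define ts where "ts = rev (sort_key d us)"
  have ts: "set ts = T" "distinct ts" and len: "length ts = card T"
    using us by (auto simp: ts_def distinct_card)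
  have "image_mset d (mset_set T) = mset (map d us)"
    using us by (metis mset_map mset_set_set)
  then have ds: "rev (sorted_list_of_multiset (image_mset d (mset_set T))) = map d ts"
    by (metis (no_types, lifting) mset_map mset_sort rev_map sort_key_simps(1) sorted_list_of_multiset_mset
        sorted_sort_key sorted_sort_id ts_def)
  have dec: "d (ts ! j) \<le> d (ts ! i)" if "i \<le> j" "j < card T" for i j
  proof -
    have "sorted (rev (map d ts))"
      by (simp add: ts_def rev_map)
    then show ?thesis
      using that len by (simp add: sorted_rev_iff_nth_mono)
  qed
  define c where "c = d (ts ! (m - 1))"
  have inj: "bij_betw ((!) ts) {..<card T} T"
    using ts len by (metis bij_betw_nth)
  have "(\<Sum>t\<in>T. real (d t) * w t) = (\<Sum>t\<in>T. (real (d t) - real c) * w t) + c * sum w T"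
    by (simp add: sum_distrib_left sum.distrib [symmetric] algebra_simps)
  also have "(\<Sum>t\<in>T. (real (d t) - real c) * w t)
               = (\<Sum>i<card T. (real (d (ts ! i)) - real c) * w (ts ! i))"
    using sum.reindex_bij_betw [OF inj, symmetric] by fast
  also have "\<dots> \<le> (\<Sum>i<card T. if i < m then real (d (ts ! i)) - real c else 0)"
  proof (rule sum_mono)
    fix i assume "i \<in> {..<card T}"
    then have i: "i < card T" and "ts ! i \<in> T"
      using ts len by auto
    then have w': "0 \<le> w (ts ! i)" "w (ts ! i) \<le> 1"
      using w by auto
    show "(real (d (ts ! i)) - real c) * w (ts ! i)
            \<le> (if i < m then real (d (ts ! i)) - real c else 0)"
    proof (cases "i < m")
      case True
      then have "c \<le> d (ts ! i)"
        unfolding c_def using m False by (intro dec) auto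
      then show ?thesis
        using True w' by (simp add: mult_left_le)
    next
      case no: False
      then have "d (ts ! i) \<le> c"
        unfolding c_def using i by (intro dec) auto
      then show ?thesis
        using no w' by (simp add: mult_nonpos_nonneg)
    qed
  qed
  also have "\<dots> = (\<Sum>i<m. real (d (ts ! i)) - real c)"
    using m by (intro sum.mono_neutral_cong_right) auto
  also have "\<dots> = (\<Sum>i<m. real (d (ts ! i))) - c * m"
    by (simp add: sum_subtractf)
  also have "(\<Sum>i<m. real (d (ts ! i))) = (\<Sum>i<m. real (map d ts ! i))"
    using m len by (intro sum.cong) auto
  also have "\<dots> = (\<Sum>i = 1..m. real (ith_largest (image_mset d (mset_set T)) i))"
    by (rule sum.reindex_bij_witness [of _ "\<lambda>i. i - 1" Suc]) (auto simp: ith_largest_def ds)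
  finally show ?thesis
    using mult_left_mono [OF sum_w, of "real c"] by simp
qed

text \<open>Bessel's inequality for orthogonal vectors \<open>z i\<close> of squared norm
  \<open>l i\<close>, where \<open>y i\<close> is the coefficient of \<open>z i\<close> in the
  projection of \<open>a\<close>: expand the squared distance from \<open>a\<close> to that
  projection. Avoiding normalization allows \<open>l i = 0\<close>.\<close>

lemma sum_weighted_projections_le:
  fixes a :: "'c \<Rightarrow> real" and z :: "'i \<Rightarrow> 'c \<Rightarrow> real" and y :: "'i \<Rightarrow> real"
  assumes I: "finite I"
    and orth: "\<And>i j. i \<in> I \<Longrightarrow> j \<in> I \<Longrightarrow> (\<Sum>s\<in>S. z i s * z j s) = (if i = j then l i else 0)"
    and proj: "\<And>i. i \<in> I \<Longrightarrow> (\<Sum>s\<in>S. a s * z i s) = l i * y i"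
  shows "(\<Sum>i\<in>I. l i * (y i)\<^sup>2) \<le> (\<Sum>s\<in>S. (a s)\<^sup>2)"
proof -
  have sq: "(\<Sum>s\<in>S. (\<Sum>i\<in>I. y i * z i s)\<^sup>2) = (\<Sum>i\<in>I. l i * (y i)\<^sup>2)"
  proof -
    have "(\<Sum>s\<in>S. (\<Sum>i\<in>I. y i * z i s)\<^sup>2)
            = (\<Sum>s\<in>S. \<Sum>i\<in>I. \<Sum>j\<in>I. y i * y j * (z i s * z j s))"
      by (simp add: power2_eq_square sum_product mult_ac)
    also have "\<dots> = (\<Sum>i\<in>I. \<Sum>j\<in>I. y i * y j * (\<Sum>s\<in>S. z i s * z j s))"
      by (subst sum.swap, rule sum.cong [OF refl], subst sum.swap) (simp add: sum_distrib_left)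
    also have "\<dots> = (\<Sum>i\<in>I. \<Sum>j\<in>I. if i = j then l i * (y i)\<^sup>2 else 0)"
      by (intro sum.cong refl) (auto simp: orth power2_eq_square)
    finally show ?thesis
      using I by simp
  qed
  have mixed: "(\<Sum>s\<in>S. a s * (\<Sum>i\<in>I. y i * z i s)) = (\<Sum>i\<in>I. l i * (y i)\<^sup>2)"
  proof -
    have "(\<Sum>s\<in>S. a s * (\<Sum>i\<in>I. y i * z i s)) = (\<Sum>i\<in>I. y i * (\<Sum>s\<in>S. a s * z i s))"
      by (simp add: sum_distrib_left, subst sum.swap) (simp add: mult_ac)
    also have "\<dots> = (\<Sum>i\<in>I. l i * (y i)\<^sup>2)"
      by (intro sum.cong refl) (simp add: proj power2_eq_square)
    finally show ?thesis .
  qed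
  have "0 \<le> (\<Sum>s\<in>S. (a s - (\<Sum>i\<in>I. y i * z i s))\<^sup>2)"
    by (simp add: sum_nonneg)
  also have "\<dots> = (\<Sum>s\<in>S. (a s)\<^sup>2) - (\<Sum>i\<in>I. l i * (y i)\<^sup>2)"
    by (simp add: power2_diff sum.distrib sum_subtractf sq mult.assoc
        sum_distrib_left [symmetric] mixed)
  finally show ?thesis by simp
qed

text \<open>The weight of a row is the \<open>q\<close>-mass of the columns meeting it, cut off at
  1. Each column meets at most \<open>h\<close> rows and the total mass is at most
  \<open>card I\<close>, which bounds the total weight.\<close>

lemma sum_eigenvalues_le_weighted_sum:
  fixes B :: "'b \<Rightarrow> 'c \<Rightarrow> real" and x :: "'i \<Rightarrow> 'b \<Rightarrow> real" and d :: "'b \<Rightarrow> nat"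
  assumes fin: "finite T" "finite S" "finite I"
    and orth: "\<And>i j. i \<in> I \<Longrightarrow> j \<in> I \<Longrightarrow> (\<Sum>t\<in>T. x i t * x j t) = (if i = j then 1 else 0)"
    and eig: "\<And>i t. i \<in> I \<Longrightarrow> t \<in> T \<Longrightarrow>
                (\<Sum>u\<in>T. (\<Sum>s\<in>S. B t s * B u s) * x i u) = l i * x i t"
    and deg: "\<And>t. t \<in> T \<Longrightarrow> (\<Sum>s\<in>S. (B t s)\<^sup>2) = real (d t)"
    and col: "\<And>s. s \<in> S \<Longrightarrow> card {t \<in> T. B t s \<noteq> 0} \<le> h"
  obtains w where "\<And>t. t \<in> T \<Longrightarrow> 0 \<le> w t" "\<And>t. t \<in> T \<Longrightarrow> w t \<le> 1"
    "sum w T \<le> real (h * card I)" "sum l I \<le> (\<Sum>t\<in>T. real (d t) * w t)"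
proof -
  define z where "z i s = (\<Sum>t\<in>T. B t s * x i t)" for i s
  \<comment> \<open>If \<open>l i = 0\<close> then \<open>z i\<close> vanishes on \<open>S\<close>, so the junk value \<open>a / 0 = 0\<close> is harmless.\<close>
  define q where "q s = (\<Sum>i\<in>I. (z i s)\<^sup>2 / l i)" for s
  \<comment> \<open>The two arguments of \<open>min\<close> are the factors of \<open>d t\<close>
    supplied by Bessel and by Cauchy-Schwarz.\<close>
  define w where "w t = min 1 (\<Sum>s | s \<in> S \<and> B t s \<noteq> 0. q s)" for t
  have proj: "(\<Sum>s\<in>S. B t s * z i s) = l i * x i t" if "i \<in> I" "t \<in> T" for i t
  proof -
    have "(\<Sum>s\<in>S. B t s * z i s) = (\<Sum>u\<in>T. (\<Sum>s\<in>S. B t s * B u s) * x i u)"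
      unfolding z_def sum_distrib_left sum_distrib_right
      by (subst sum.swap) (simp add: mult_ac)
    then show ?thesis using eig that by simp
  qed
  have orth_z: "(\<Sum>s\<in>S. z i s * z j s) = (if i = j then l i else 0)" if "i \<in> I" "j \<in> I" for i j
  proof -
    have "(\<Sum>s\<in>S. z i s * z j s) = (\<Sum>t\<in>T. x j t * (\<Sum>s\<in>S. B t s * z i s))"
      unfolding z_def [of j] sum_distrib_left
      by (subst sum.swap) (simp add: mult_ac)
    also have "\<dots> = l i * (\<Sum>t\<in>T. x i t * x j t)"
      using that by (simp add: proj sum_distrib_left mult_ac)
    finally show ?thesis using orth that by simp
  qed
  have l_nonneg: "0 \<le> l i" if "i \<in> I" for i
    using orth_z [OF that that] sum_nonneg [of S "\<lambda>s. z i s * z i s"] by simp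
  have q_nonneg: "0 \<le> q s" for s
    unfolding q_def by (intro sum_nonneg divide_nonneg_nonneg) (auto simp: l_nonneg)
  have sum_q: "sum q S \<le> card I"
  proof -
    have "sum q S = (\<Sum>i\<in>I. (\<Sum>s\<in>S. z i s * z i s) / l i)"
      unfolding q_def by (subst sum.swap) (simp add: sum_divide_distrib power2_eq_square)
    also have "\<dots> = (\<Sum>i\<in>I. l i / l i)"
      by (intro sum.cong refl) (simp add: orth_z)
    \<comment> \<open>Each quotient is 1, or 0 if \<open>l i = 0\<close>.\<close>
    also have "\<dots> \<le> (\<Sum>i\<in>I. 1)"
      by (intro sum_mono) simp
    finally show ?thesis by simp
  qed
  show thesis
  proof (rule that [of w])
    show "0 \<le> w t" for t
      unfolding w_def by (simp add: q_nonneg sum_nonneg)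
    show "w t \<le> 1" for t
      unfolding w_def by simp
    have "sum w T \<le> (\<Sum>t\<in>T. \<Sum>s\<in>S. if B t s \<noteq> 0 then q s else 0)"
      unfolding w_def using fin by (intro sum_mono) (simp add: sum.inter_filter)
    also have "\<dots> = (\<Sum>s\<in>S. real (card {t \<in> T. B t s \<noteq> 0}) * q s)"
      using fin by (subst sum.swap) (simp add: sum.inter_filter [symmetric])
    also have "\<dots> \<le> (\<Sum>s\<in>S. real h * q s)"
      using col by (intro sum_mono mult_right_mono q_nonneg) simp
    also have "\<dots> \<le> real (h * card I)"
      using sum_q by (simp add: sum_distrib_left [symmetric] mult_left_mono)
    finally show "sum w T \<le> real (h * card I)" .
    have bound: "(\<Sum>i\<in>I. l i * (x i t)\<^sup>2) \<le> real (d t) * w t" if t: "t \<in> T" for t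
    proof -
      have bessel: "(\<Sum>i\<in>I. l i * (x i t)\<^sup>2) \<le> real (d t)"
        using sum_weighted_projections_le [OF fin(3) orth_z proj [OF _ t]] deg [OF t] by simp
      have "(\<Sum>i\<in>I. l i * (x i t)\<^sup>2)
              \<le> (\<Sum>i\<in>I. real (d t) * ((\<Sum>s | s \<in> S \<and> B t s \<noteq> 0. (z i s)\<^sup>2) / l i))"
      proof (rule sum_mono)
        fix i assume i: "i \<in> I"
        \<comment> \<open>Restricting to the support of row \<open>t\<close> before Cauchy-Schwarz
          keeps only the part of \<open>z i\<close> on columns meeting \<open>t\<close>, not its
          full norm.\<close>
        have "(l i * x i t)\<^sup>2 = (\<Sum>s | s \<in> S \<and> B t s \<noteq> 0. B t s * z i s)\<^sup>2"
          unfolding proj [OF i t, symmetric] using fin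
          by (intro arg_cong [where f = "\<lambda>a. a\<^sup>2"] sum.mono_neutral_right) auto
        also have "\<dots> \<le> (\<Sum>s | s \<in> S \<and> B t s \<noteq> 0. (B t s)\<^sup>2)
                          * (\<Sum>s | s \<in> S \<and> B t s \<noteq> 0. (z i s)\<^sup>2)"
          by (rule Cauchy_Schwarz_ineq_sum)
        also have "(\<Sum>s | s \<in> S \<and> B t s \<noteq> 0. (B t s)\<^sup>2) = real (d t)"
          unfolding deg [OF t, symmetric] using fin by (intro sum.mono_neutral_left) auto
        finally show "l i * (x i t)\<^sup>2
              \<le> real (d t) * ((\<Sum>s | s \<in> S \<and> B t s \<noteq> 0. (z i s)\<^sup>2) / l i)"
          \<comment> \<open>Divide by \<open>l i\<close>; if it is 0, both sides vanish.\<close>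
          using l_nonneg [OF i]
          by (cases "l i = 0") (auto simp: field_simps power2_eq_square)
      qed
      also have "\<dots> = real (d t) * (\<Sum>s | s \<in> S \<and> B t s \<noteq> 0. q s)"
        unfolding q_def sum_distrib_left [symmetric]
        by (subst sum.swap) (simp add: sum_divide_distrib)
      finally show ?thesis
        using bessel unfolding w_def by (simp add: min_def)
    qed
    have "sum l I = (\<Sum>i\<in>I. l i * (\<Sum>t\<in>T. (x i t)\<^sup>2))"
      by (intro sum.cong refl) (simp add: orth power2_eq_square)
    also have "\<dots> = (\<Sum>t\<in>T. \<Sum>i\<in>I. l i * (x i t)\<^sup>2)"
      by (simp add: sum_distrib_left, rule sum.swap)
    also have "\<dots> \<le> (\<Sum>t\<in>T. real (d t) * w t)"
      by (intro sum_mono bound)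
    finally show "sum l I \<le> (\<Sum>t\<in>T. real (d t) * w t)" .
  qed
qed

subsection \<open>Real symmetric matrices\<close>

text \<open>Symmetry moves the matrix across the Hermitian product, and real entries let it commute
  with conjugation. Evaluating the product of \<open>C *\<^sub>v v\<close> with \<open>v\<close>
  both ways gives \<open>a = cnj a\<close>.\<close>

lemma symmetric_eigenvalue_real:
  fixes A :: "real mat"
  assumes A: "A \<in> carrier_mat n n" and sym: "transpose_mat A = A"
    and ev: "eigenvalue (map_mat complex_of_real A) a"
  shows "a \<in> \<real>"
proof -
  define C where "C = map_mat complex_of_real A"
  have C: "C \<in> carrier_mat n n" and symC: "transpose_mat C = C"
    using A sym by (simp_all add: C_def map_mat_transpose)
  have conjC: "conjugate (C *\<^sub>v v) = C *\<^sub>v conjugate v" if "v \<in> carrier_vec n" for v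
    using that A by (intro eq_vecI) (auto simp: C_def scalar_prod_def sum_conjugate conjugate_dist_mul)
  obtain v where v: "v \<in> carrier_vec n" "v \<noteq> 0\<^sub>v n" "C *\<^sub>v v = a \<cdot>\<^sub>v v"
    using ev C unfolding eigenvalue_def eigenvector_def C_def by auto
  have cv: "conjugate v \<in> carrier_vec n"
    using v(1) by simp
  have "a * (v \<bullet>c v) = (C *\<^sub>v v) \<bullet>c v"
    using v(1,3) cv by simp
  also have "\<dots> = v \<bullet> (C *\<^sub>v conjugate v)"
    using transpose_vec_mult_scalar [OF C cv v(1)] symC by (simp add: C)
  also have "C *\<^sub>v conjugate v = cnj a \<cdot>\<^sub>v conjugate v"
    using conjC [OF v(1)] v(3) by (simp add: conjugate_smult_vec)
  also have "v \<bullet> (cnj a \<cdot>\<^sub>v conjugate v) = cnj a * (v \<bullet>c v)"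
    using v(1) cv by simp
  finally have "a = cnj a"
    using v by simp
  then show ?thesis
    by (metis Reals_cnj_iff)
qed

text \<open>The polynomial splits over the complex numbers, its roots are real by the previous
  lemma, and the embedding of the reals is injective on coefficients.\<close>

lemma symmetric_char_poly_splits:
  fixes A :: "real mat"
  assumes A: "A \<in> carrier_mat n n" and sym: "transpose_mat A = A"
  obtains es where "char_poly A = (\<Prod>e\<leftarrow>es. [:- e, 1:])"
proof -
  interpret map_hom: map_poly_comm_ring_hom complex_of_real ..
  define C where "C = map_mat complex_of_real A"
  have C: "C \<in> carrier_mat n n"
    using A by (simp add: C_def)
  obtain as where as: "char_poly C = (\<Prod>a\<leftarrow>as. [:- a, 1:])"
    using char_poly_factorized [OF C] by blast
  have real: "complex_of_real (Re a) = a" if "a \<in> set as" for a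
  proof -
    have "poly (char_poly C) a = 0"
      unfolding as using that by (auto simp: poly_prod_list prod_list_zero_iff)
    then have "eigenvalue C a"
      using eigenvalue_root_char_poly [OF C] by simp
    then show ?thesis
      using symmetric_eigenvalue_real [OF A sym] unfolding C_def by (metis of_real_Re)
  qed
  have "map_poly complex_of_real (char_poly A) = char_poly C"
    unfolding C_def by (simp add: of_real_hom.char_poly_hom [OF A])
  also have "\<dots> = (\<Prod>a\<leftarrow>map (complex_of_real \<circ> Re) as. [:- a, 1:])"
    unfolding as using real by (simp add: map_idI)
  also have "\<dots> = map_poly complex_of_real (\<Prod>e\<leftarrow>map Re as. [:- e, 1:])"
    by (simp add: map_hom.hom_prod_list o_def)
  finally have "char_poly A = (\<Prod>e\<leftarrow>map Re as. [:- e, 1:])"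
    by (metis (no_types, lifting) coeff_map_poly of_real_0 of_real_eq_iff poly_eqI)
  then show thesis
    by (rule that)
qed

text \<open>Complete \<open>v\<close> to a basis, orthogonalize and normalize; Gram-Schmidt leaves
  the first vector unchanged, so the first column stays a multiple of \<open>v\<close>.\<close>

lemma orthogonal_mat_extending_vec:
  fixes v :: "real vec"
  assumes v: "v \<in> carrier_vec n" and v0: "v \<noteq> 0\<^sub>v n" and n: "n \<noteq> 0"
  obtains W c where "W \<in> carrier_mat n n" "transpose_mat W * W = 1\<^sub>m n" "col W 0 = c \<cdot>\<^sub>v v"
proof -
  interpret cof_vec_space n "TYPE(real)" .
  define b where "b = basis_completion v"
  define ws where "ws = gram_schmidt n b"
  note bc = basis_completion [OF v v0, folded b_def]
  obtain vs where bv: "b = v # vs"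
    using bc(6,7) n by (cases b) auto
  have "set ws \<subseteq> carrier_vec n" and orth: "corthogonal ws" and len: "length ws = n"
    using gram_schmidt_result [OF bc(2,4,5) refl, folded ws_def] bc(6) by auto
  then have ws: "ws ! i \<in> carrier_vec n" if "i < n" for i
    using that nth_mem by blast
  have orth': "ws ! i \<bullet> ws ! j = 0 \<longleftrightarrow> i \<noteq> j" if "i < n" "j < n" for i j
    using corthogonalD [OF orth] that len by simp
  have pos: "0 < ws ! i \<bullet> ws ! i" if "i < n" for i
    using conjugate_square_ge_0_vec [of "ws ! i"] orth' [OF that that] by simp
  have ws0: "ws ! 0 = v"
    using gram_schmidt_hd [OF v, of vs, folded bv] n len
    by (metis hd_conv_nth length_0_conv ws_def)
  define u where "u i = (1 / sqrt (ws ! i \<bullet> ws ! i)) \<cdot>\<^sub>v ws ! i" for i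
  define W where "W = mat_of_cols n (map u [0..<n])"
  have W: "W \<in> carrier_mat n n"
    unfolding W_def by (metis diff_zero length_map length_upt mat_of_cols_carrier(1))
  have u: "u i \<in> carrier_vec n" if "i < n" for i
    using ws [OF that] by (simp add: u_def)
  have colW: "col W i = u i" if "i < n" for i
    unfolding W_def using that u by (subst col_mat_of_cols) auto
  have "u i \<bullet> u j = (if i = j then 1 else 0)" if "i < n" "j < n" for i j
  proof -
    have "u i \<bullet> u j = 1 / sqrt (ws ! i \<bullet> ws ! i) * (1 / sqrt (ws ! j \<bullet> ws ! j)) * (ws ! i \<bullet> ws ! j)"
      unfolding u_def using ws [OF that(1)] ws [OF that(2)]
      by (simp add: scalar_prod_smult_distrib [of _ n] smult_scalar_prod_distrib [of _ n])
    then show ?thesis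
      using orth' [OF that] pos [OF that(1)] by (auto simp: field_simps)
  qed
  then have "transpose_mat W * W = 1\<^sub>m n"
    using W by (intro eq_matI) (auto simp: colW)
  moreover have "col W 0 = (1 / sqrt (v \<bullet> v)) \<cdot>\<^sub>v v"
    using n by (simp add: colW u_def ws0)
  ultimately show thesis
    using that W by blast
qed

text \<open>Deflation along \<open>es\<close>: an orthogonal change of basis splits off the head
  eigenvalue as a 1 by 1 block, and the other block has the tail as its roots. Since the order of
  \<open>es\<close> is arbitrary, the diagonal can later be chosen decreasing.\<close>

lemma symmetric_orthogonal_diagonalization:
  fixes A :: "real mat"
  assumes "A \<in> carrier_mat n n" and "transpose_mat A = A"
    and "char_poly A = (\<Prod>e\<leftarrow>es. [:- e, 1:])"
  shows "\<exists>P D. P \<in> carrier_mat n n \<and> D \<in> carrier_mat n n \<and> transpose_mat P * P = 1\<^sub>m n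
           \<and> A * P = P * D \<and> diagonal_mat D \<and> diag_mat D = es"
  using assms
proof (induction es arbitrary: n A)
  case Nil
  then have "n = 0"
    using degree_monic_char_poly [OF Nil(1)] by simp
  then show ?case
    using Nil(1) by (intro exI [of _ "1\<^sub>m 0"]) (auto simp: diagonal_mat_def diag_mat_def)
next
  case (Cons e es n A)
  note A = Cons.prems(1) and symA = Cons.prems(2)
  have cp: "char_poly A = [:- e, 1:] * (\<Prod>e\<leftarrow>es. [:- e, 1:])"
    using Cons.prems(3) by simp
  define m where "m = n - 1"
  have "degree (char_poly A) = Suc (degree (\<Prod>e\<leftarrow>es. [:- e, 1:]))"
    unfolding cp by (subst degree_mult_eq) (auto simp: prod_list_zero_iff)
  then have n: "n = Suc m" "n \<noteq> 0"
    using degree_monic_char_poly [OF A] by (auto simp: m_def)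
  have "eigenvalue A e"
    unfolding eigenvalue_root_char_poly [OF A] cp by simp
  then obtain v where v: "v \<in> carrier_vec n" "v \<noteq> 0\<^sub>v n" "A *\<^sub>v v = e \<cdot>\<^sub>v v"
    using A unfolding eigenvalue_def eigenvector_def by auto
  obtain W c where W: "W \<in> carrier_mat n n" and WW: "transpose_mat W * W = 1\<^sub>m n"
    and W0: "col W 0 = c \<cdot>\<^sub>v v"
    using orthogonal_mat_extending_vec [OF v(1,2) n(2)] by metis
  let ?W' = "transpose_mat W"
  have W': "?W' \<in> carrier_mat n n"
    using W by simp
  have WW': "W * ?W' = 1\<^sub>m n"
    using mat_mult_left_right_inverse [OF W' W WW] .
  define A' where "A' = ?W' * A * W"
  have A': "A' \<in> carrier_mat n n"
    using A W by (simp add: A'_def)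
  have AW: "A * W = W * A'"
  proof -
    have "W * A' = (W * ?W') * (A * W)"
      unfolding A'_def using A W W' by (simp add: assoc_mult_mat [of _ n n _ n _ n])
    then show ?thesis
      using A W by (simp add: WW')
  qed
  have symA': "transpose_mat A' = A'"
    unfolding A'_def using A W symA
    by (simp add: transpose_mult [of _ n n _ n] assoc_mult_mat [of _ n n _ n _ n])
  \<comment> \<open>The first column of \<open>W\<close> is an eigenvector for \<open>e\<close>, and
    \<open>?W'\<close> sends it to the first unit vector.\<close>
  have col0: "A' $$ (i, 0) = (if i = 0 then e else 0)" if i: "i < n" for i
  proof -
    have "A *\<^sub>v col W 0 = e \<cdot>\<^sub>v col W 0"
      unfolding W0 using A v by (simp add: mult_mat_vec smult_smult_assoc mult.commute)
    moreover have "col A' 0 = ?W' *\<^sub>v (A *\<^sub>v col W 0)"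
      unfolding A'_def assoc_mult_mat [OF W' A W]
      using A W W' n(2) by (metis col_mult2 mult_carrier_mat neq0_conv)
    moreover have "?W' *\<^sub>v (e \<cdot>\<^sub>v col W 0) = e \<cdot>\<^sub>v (?W' *\<^sub>v col W 0)"
      by (rule mult_mat_vec [OF W']) (use W n(2) in \<open>auto intro: col_carrier_vec\<close>)
    ultimately have "col A' 0 = e \<cdot>\<^sub>v (?W' *\<^sub>v col W 0)"
      by simp
    also have "?W' *\<^sub>v col W 0 = col (?W' * W) 0"
      using col_mult2 [OF W' W] n(2) by simp
    also have "\<dots> = unit_vec n 0"
      unfolding WW using n(2) by simp
    finally have "col A' 0 $ i = (e \<cdot>\<^sub>v unit_vec n 0) $ i"
      by simp
    then show ?thesis
      using A' i n(2) by simp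
  qed
  define A3 where "A3 = mat m m (\<lambda>(i, j). A' $$ (Suc i, Suc j))"
  have A3: "A3 \<in> carrier_mat m m"
    by (simp add: A3_def)
  have A'_sym: "A' $$ (i, j) = A' $$ (j, i)" if "i < n" "j < n" for i j
    using symA' A' that by (metis carrier_matD index_transpose_mat(1))
  \<comment> \<open>Symmetry clears the first row as \<open>col0\<close> clears the first
    column.\<close>
  have block: "A' = four_block_mat (mat 1 1 (\<lambda>_. e)) (0\<^sub>m 1 m) (0\<^sub>m m 1) A3"
    using A' n(1) col0 A'_sym [of 0]
    by (intro eq_matI) (auto simp: A3_def less_Suc_eq_0_disj)
  have symA3: "transpose_mat A3 = A3"
    using A'_sym n(1) by (intro eq_matI) (auto simp: A3_def)
  have "similar_mat A' A"
    unfolding similar_mat_def similar_mat_wit_def Let_def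
    using A A' W W' WW WW' by (intro exI [of _ ?W'] exI [of _ W]) (auto simp: A'_def)
  then have "char_poly A' = [:- e, 1:] * (\<Prod>e\<leftarrow>es. [:- e, 1:])"
    using char_poly_similar cp by metis
  moreover have "char_poly A' = char_poly (mat 1 1 (\<lambda>_. e)) * char_poly A3"
    unfolding block by (rule char_poly_four_block_zeros_col) (auto simp: A3)
  moreover have "char_poly (mat 1 1 (\<lambda>_. e)) = [:- e, 1:]"
    by (simp add: char_poly_defs det_def sign_def)
  ultimately have "char_poly A3 = (\<Prod>e\<leftarrow>es. [:- e, 1:])"
    by (metis mult_cancel_left pCons_eq_0_iff zero_neq_one)
  then obtain P D where P: "P \<in> carrier_mat m m" and D: "D \<in> carrier_mat m m"
    and PP: "transpose_mat P * P = 1\<^sub>m m" and AP: "A3 * P = P * D"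
    and diag: "diagonal_mat D" "diag_mat D = es"
    using Cons.IH [OF A3 symA3] by blast
  \<comment> \<open>The diagonalization of the smaller block is padded by the eigenvalue
    \<open>e\<close>; \<open>W * F\<close> then diagonalizes \<open>A\<close>.\<close>
  define F where "F = four_block_mat (1\<^sub>m 1) (0\<^sub>m 1 m) (0\<^sub>m m 1) P"
  define E where "E = four_block_mat (mat 1 1 (\<lambda>_. e)) (0\<^sub>m 1 m) (0\<^sub>m m 1) D"
  have F: "F \<in> carrier_mat n n" and E: "E \<in> carrier_mat n n"
    using P D n by (auto simp: F_def E_def)
  have F': "transpose_mat F = four_block_mat (1\<^sub>m 1) (0\<^sub>m 1 m) (0\<^sub>m m 1) (transpose_mat P)"
    unfolding F_def using P by (subst transpose_four_block_mat) auto
  have FF: "transpose_mat F * F = 1\<^sub>m n"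
    unfolding F' unfolding F_def using P PP n
    by (subst mult_four_block_mat [of _ 1 1 _ m _ m _ _ 1 _ m])
      (auto intro!: eq_matI simp: four_block_mat_def Let_def)
  have AF: "A' * F = F * E"
    unfolding block F_def E_def using P D A3 AP
    by (simp add: mult_four_block_mat [of _ 1 1 _ m _ m _ _ 1 _ m])
  have "transpose_mat (W * F) * (W * F) = transpose_mat F * (?W' * W) * F"
    using W F by (simp add: transpose_mult [of _ n n _ n] assoc_mult_mat [of _ n n _ n _ n])
  then have "transpose_mat (W * F) * (W * F) = 1\<^sub>m n"
    using F by (simp add: WW FF)
  moreover have "A * (W * F) = (W * F) * E"
    unfolding assoc_mult_mat [OF A W F, symmetric] AW assoc_mult_mat [OF W A' F] AF
    by (rule assoc_mult_mat [OF W F E, symmetric])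
  moreover have "diagonal_mat E"
    using diag(1) D unfolding diagonal_mat_def E_def by (fastforce simp: less_Suc_eq_0_disj)
  moreover have "diag_mat E = e # es"
    unfolding E_def using D diag(2)
    by (subst diag_four_block_mat [of _ 1 _ m]) (auto simp: diag_mat_def)
  ultimately show ?case
    using W F E by (meson mult_carrier_mat)
qed

text \<open>Prescribing the decreasing list of roots as the diagonal makes column
  \<open>i - 1\<close> of \<open>P\<close> an eigenvector for the \<open>i\<close>-th largest
  eigenvalue.\<close>

lemma orthonormal_eigenvectors:
  fixes A :: "real mat"
  assumes A: "A \<in> carrier_mat n n" and sym: "transpose_mat A = A"
  obtains x where
    "\<And>i j. i \<in> {1..n} \<Longrightarrow> j \<in> {1..n} \<Longrightarrow> (\<Sum>t<n. x i t * x j t) = (if i = j then 1 else (0::real))"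
    "\<And>i t. i \<in> {1..n} \<Longrightarrow> t < n \<Longrightarrow> (\<Sum>u<n. A $$ (t, u) * x i u) = ith_eigenvalue A i * x i t"
proof -
  obtain es0 where es0: "char_poly A = (\<Prod>e\<leftarrow>es0. [:- e, 1:])"
    using symmetric_char_poly_splits [OF A sym] .
  define es where "es = rev (sorted_list_of_multiset (proots (char_poly A)))"
  \<comment> \<open>Hence \<open>es\<close> is a permutation of \<open>es0\<close> and yields the
    same product of linear factors.\<close>
  have "proots (char_poly A) = mset es0"
    unfolding es0
  proof (induction es0)
    case (Cons e es)
    have "(\<Prod>e\<leftarrow>es. [:- e, 1:]) \<noteq> 0"
      by (auto simp: prod_list_zero_iff)
    then have "proots ([:- e, 1:] * (\<Prod>e\<leftarrow>es. [:- e, 1:]))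
        = proots [:- e, 1:] + proots (\<Prod>e\<leftarrow>es. [:- e, 1:])"
      by (intro proots_mult) auto
    then show ?case
      using Cons by (simp del: mult_pCons_left)
  qed simp
  then have "mset es = mset es0"
    by (simp add: es_def)
  then have es: "char_poly A = (\<Prod>e\<leftarrow>es. [:- e, 1:])"
    unfolding es0 by (metis mset_map prod_mset_prod_list)
  obtain P D where P: "P \<in> carrier_mat n n" and D: "D \<in> carrier_mat n n"
    and PP: "transpose_mat P * P = 1\<^sub>m n" and AP: "A * P = P * D"
    and diag: "diagonal_mat D" "diag_mat D = es"
    using symmetric_orthogonal_diagonalization [OF A sym es] by blast
  show thesis
  proof (rule that [of "\<lambda>i t. P $$ (t, i - 1)"])
    fix i j assume ij: "i \<in> {1..n}" "j \<in> {1..n}"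
    then have "(\<Sum>t<n. P $$ (t, i - 1) * P $$ (t, j - 1)) = (transpose_mat P * P) $$ (i - 1, j - 1)"
      using P by (auto simp: scalar_prod_def lessThan_atLeast0)
    then show "(\<Sum>t<n. P $$ (t, i - 1) * P $$ (t, j - 1)) = (if i = j then 1 else 0)"
      unfolding PP using ij by auto
  next
    fix i t assume i: "i \<in> {1..n}" and t: "t < n"
    define k where "k = i - 1"
    have k: "k < n"
      using i by (auto simp: k_def)
    have "(\<Sum>u<n. A $$ (t, u) * P $$ (u, k)) = (A * P) $$ (t, k)"
      using A P t k by (simp add: scalar_prod_def lessThan_atLeast0)
    also have "\<dots> = (\<Sum>u<n. P $$ (t, u) * D $$ (u, k))"
      unfolding AP using P D t k by (simp add: scalar_prod_def lessThan_atLeast0)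
    also have "\<dots> = (\<Sum>u<n. if u = k then P $$ (t, k) * D $$ (k, k) else 0)"
      using diag(1) D k by (intro sum.cong) (auto simp: diagonal_mat_def)
    also have "\<dots> = D $$ (k, k) * P $$ (t, k)"
      using k by simp
    also have "D $$ (k, k) = es ! k"
      unfolding diag(2) [symmetric] using D k by (simp add: diag_mat_def)
    finally show "(\<Sum>u<n. A $$ (t, u) * P $$ (u, i - 1)) = ith_eigenvalue A i * P $$ (t, i - 1)"
      by (simp add: ith_eigenvalue_def ith_largest_def es_def k_def)
  qed
qed

subsection \<open>The incidence matrix\<close>

lemma incidence_insert:
  assumes "u \<notin> \<sigma>"
  shows "incidence R (insert u \<sigma>) \<sigma> = (-1) ^ card {v \<in> \<sigma>. (v, u) \<in> R}"
proof -
  have "(THE w. w \<in> insert u \<sigma> - \<sigma>) = u"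
    using assms by (intro the_equality) auto
  moreover have "{v \<in> insert u \<sigma>. (v, u) \<in> R \<and> v \<noteq> u} = {v \<in> \<sigma>. (v, u) \<in> R}"
    using assms by auto
  ultimately show ?thesis
    by (simp add: incidence_def)
qed

lemma incidence_square_eq_1 [simp]: "(incidence R \<tau> \<sigma>)\<^sup>2 = 1"
  by (simp add: incidence_def Let_def flip: power_mult)

text \<open>The sign identity behind the vanishing of the squared boundary map. Passing from \<rho>
  to the larger face adds \<open>u\<close> to the vertices counted below \<open>w\<close>, or
  \<open>w\<close> to those below \<open>u\<close>; linearity of the order makes exactly one of
  these happen, so exactly one sign flips.\<close>

lemma incidence_diamond:
  assumes R: "linear_order_on V R" and \<rho>: "finite \<rho>"
    and V: "u \<in> V" "w \<in> V" and uw: "u \<noteq> w" "u \<notin> \<rho>" "w \<notin> \<rho>"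
  shows "incidence R (insert u (insert w \<rho>)) (insert u \<rho>)
           * incidence R (insert u (insert w \<rho>)) (insert w \<rho>)
         = - (incidence R (insert u \<rho>) \<rho> * incidence R (insert w \<rho>) \<rho>)"
proof -
  define a b where "a = card {v \<in> \<rho>. (v, u) \<in> R}" and "b = card {v \<in> \<rho>. (v, w) \<in> R}"
  have ins: "card {v \<in> insert x \<rho>. (v, y) \<in> R} = card {v \<in> \<rho>. (v, y) \<in> R} + (if (x, y) \<in> R then 1 else 0)"
    if "x \<notin> \<rho>" for x y
  proof -
    have "{v \<in> insert x \<rho>. (v, y) \<in> R}
            = (if (x, y) \<in> R then insert x {v \<in> \<rho>. (v, y) \<in> R} else {v \<in> \<rho>. (v, y) \<in> R})"
      by auto
    then show ?thesis
      using that \<rho> by simp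
  qed
  have "incidence R (insert u (insert w \<rho>)) (insert u \<rho>) = (-1) ^ (b + (if (u, w) \<in> R then 1 else 0))"
    using incidence_insert [of w "insert u \<rho>" R] ins [of u w] uw
    by (simp add: insert_commute b_def)
  moreover have "incidence R (insert u (insert w \<rho>)) (insert w \<rho>) = (-1) ^ (a + (if (w, u) \<in> R then 1 else 0))"
    using incidence_insert [of u "insert w \<rho>" R] ins [of w u] uw
    by (simp add: a_def)
  moreover have "(u, w) \<in> R \<longleftrightarrow> (w, u) \<notin> R"
    using R V uw unfolding linear_order_on_def partial_order_on_def total_on_def antisym_def by blast
  ultimately show ?thesis
    using incidence_insert [OF uw(2), of R] incidence_insert [OF uw(3), of R]
    by (simp add: a_def b_def)
qed

text \<open>The matrix \<open>B\<close>, with rows \<tau> and columns \<sigma>. Since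
  \<open>incidence\<close> is a sign for every pair of sets, non-incident pairs must be set to 0
  explicitly.\<close>

definition boundary_coeff :: "('a \<times> 'a) set \<Rightarrow> 'a set \<Rightarrow> 'a set \<Rightarrow> real" where
  "boundary_coeff R \<tau> \<sigma> = (if \<tau> \<subseteq> \<sigma> then incidence R \<sigma> \<tau> else 0)"

lemma simplicesD:
  assumes "\<sigma> \<in> simplices X i"
  shows "\<sigma> \<in> X" "int (card \<sigma>) = i + 1"
  using assms by (auto simp: simplices_def sdim_def)

lemma sum_boundary_coeff_square:
  assumes "simplicial_complex V X"
  shows "(\<Sum>\<sigma>\<in>simplices X (int r). (boundary_coeff R \<tau> \<sigma>)\<^sup>2) = real (r_degree X r \<tau>)"
proof -
  have "finite X"
    using assms unfolding simplicial_complex_def by (meson finite_Pow_iff finite_subset)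
  then have "finite (simplices X (int r))"
    by (simp add: simplices_def)
  moreover have "(boundary_coeff R \<tau> \<sigma>)\<^sup>2 = (if \<tau> \<subseteq> \<sigma> then 1 else 0)" for \<sigma>
    by (simp add: boundary_coeff_def)
  ultimately show ?thesis
    by (simp add: r_degree_def flip: sum.inter_filter)
qed

text \<open>Entrywise, this is the factorization of the Laplacian as \<open>B B\<^sup>T\<close>. Off
  the diagonal only the union of the two faces can contribute, and the diamond identity rewrites its
  sign product through their intersection.\<close>

lemma upper_laplacian_eq_sum:
  assumes X: "simplicial_complex V X" and R: "linear_order_on V R"
    and \<tau>: "\<tau> \<in> simplices X (int r - 1)" and \<eta>: "\<eta> \<in> simplices X (int r - 1)"
  shows "upper_laplacian R X r \<tau> \<eta>
           = (\<Sum>\<sigma>\<in>simplices X (int r). boundary_coeff R \<tau> \<sigma> * boundary_coeff R \<eta> \<sigma>)"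
proof (cases "\<tau> = \<eta>")
  case True
  then show ?thesis
    using sum_boundary_coeff_square [OF X, of R \<tau> r]
    by (simp add: upper_laplacian_def power2_eq_square)
next
  case neq: False
  have fin: "finite X" "finite \<sigma>" "\<sigma> \<subseteq> V" if "\<sigma> \<in> X" for \<sigma>
    using X that unfolding simplicial_complex_def by (auto intro: finite_subset)
  note \<tau>D = simplicesD [OF \<tau>] and \<eta>D = simplicesD [OF \<eta>]
  have finS: "finite (simplices X (int r))"
    using fin(1) [OF \<tau>D(1)] by (simp add: simplices_def)
  have card_Int: "card (\<tau> \<inter> \<eta>) < r"
    using neq \<tau>D \<eta>D fin(2) by (metis Int_lower1 Int_lower2 add_diff_cancel_right' card_seteq
        diff_add_cancel leI of_nat_eq_iff)
  have card_Un: "card (\<tau> \<union> \<eta>) + card (\<tau> \<inter> \<eta>) = 2 * r"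
    using card_Un_Int [of \<tau> \<eta>] \<tau>D \<eta>D fin(2) by simp
  \<comment> \<open>An \<open>r\<close>-simplex containing both faces equals their union, which
    already has at least \<open>r + 1\<close> elements.\<close>
  have term_0: "boundary_coeff R \<tau> \<sigma> * boundary_coeff R \<eta> \<sigma> = 0"
    if "\<sigma> \<in> simplices X (int r)" "\<sigma> \<noteq> \<tau> \<union> \<eta>" for \<sigma>
  proof (rule ccontr)
    assume "\<not> ?thesis"
    then have sub: "\<tau> \<union> \<eta> \<subseteq> \<sigma>"
      by (auto simp: boundary_coeff_def split: if_splits)
    have "finite \<sigma>" "card \<sigma> = r + 1"
      using simplicesD [OF that(1)] fin(2) by auto
    then have "\<tau> \<union> \<eta> = \<sigma>"
      using sub card_Un card_Int by (intro card_seteq) auto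
    then show False using that by simp
  qed
  have sum_eq: "(\<Sum>\<sigma>\<in>simplices X (int r). boundary_coeff R \<tau> \<sigma> * boundary_coeff R \<eta> \<sigma>)
      = (if \<tau> \<union> \<eta> \<in> simplices X (int r)
         then incidence R (\<tau> \<union> \<eta>) \<tau> * incidence R (\<tau> \<union> \<eta>) \<eta> else 0)"
  proof -
    have "(\<Sum>\<sigma>\<in>simplices X (int r). boundary_coeff R \<tau> \<sigma> * boundary_coeff R \<eta> \<sigma>)
        = (\<Sum>\<sigma>\<in>simplices X (int r). if \<sigma> = \<tau> \<union> \<eta>
             then incidence R (\<tau> \<union> \<eta>) \<tau> * incidence R (\<tau> \<union> \<eta>) \<eta> else 0)"
      using term_0 by (intro sum.cong refl) (auto simp: boundary_coeff_def)
    then show ?thesis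
      using finS by simp
  qed
  \<comment> \<open>By inclusion-exclusion the union has \<open>r + 1\<close> elements exactly when
    the intersection has \<open>r - 1\<close>, the case condition of
    \<open>upper_laplacian\<close>.\<close>
  have mem: "\<tau> \<union> \<eta> \<in> simplices X (int r) \<longleftrightarrow> int (card (\<tau> \<inter> \<eta>)) = int r - 1 \<and> \<tau> \<union> \<eta> \<in> X"
    using card_Un by (auto simp: simplices_def sdim_def)
  show ?thesis
  proof (cases "\<tau> \<union> \<eta> \<in> simplices X (int r)")
    case False
    then show ?thesis
      unfolding sum_eq using mem neq by (auto simp: upper_laplacian_def)
  next
    case True
    define \<rho> where "\<rho> = \<tau> \<inter> \<eta>"
    have \<rho>: "finite \<rho>" "int (card \<rho>) = int r - 1"
      using True mem fin(2) [OF \<tau>D(1)] by (auto simp: \<rho>_def)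
    have "card (\<tau> - \<rho>) = 1" "card (\<eta> - \<rho>) = 1"
      using \<rho> \<tau>D \<eta>D by (simp_all add: card_Diff_subset \<rho>_def)
    then obtain u w where "\<tau> - \<rho> = {u}" "\<eta> - \<rho> = {w}"
      by (meson card_1_singletonE)
    then have uw: "\<tau> = insert u \<rho>" "\<eta> = insert w \<rho>" "u \<notin> \<rho>" "w \<notin> \<rho>"
      by (auto simp: \<rho>_def)
    have "u \<noteq> w" "u \<in> V" "w \<in> V"
      using uw neq fin(3) \<tau>D(1) \<eta>D(1) by auto
    moreover have "\<tau> \<union> \<eta> = insert u (insert w \<rho>)"
      using uw by auto
    ultimately have "incidence R (\<tau> \<union> \<eta>) \<tau> * incidence R (\<tau> \<union> \<eta>) \<eta>
        = - (incidence R \<tau> \<rho> * incidence R \<eta> \<rho>)"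
      using incidence_diamond [OF R \<rho>(1), of u w] uw by simp
    then show ?thesis
      unfolding sum_eq using True mem neq by (simp add: upper_laplacian_def \<rho>_def)
  qed
qed

section \<open>Eigenvalue sums of the upper Laplacian against degree sums\<close>

theorem theorem1p6:
  fixes V :: "'a set" and X :: "'a set set" and R :: "('a \<times> 'a) set"
    and fs :: "'a set list" and r k :: nat
  assumes "simplicial_complex V X"
    and "linear_order_on V R"
    and "1 \<le> r" and "int r \<le> cdim X"
    and "distinct fs" and "set fs = simplices X (int r - 1)"
    and "1 \<le> k" and "real k \<le> real (face_number X (int r - 1)) / (real r + 1)"
  shows "(\<Sum>i = 1..k. ith_eigenvalue (indexed_mat fs (upper_laplacian R X r)) i)
           \<le> real (\<Sum>i = 1..(r + 1) * k. ith_degree X r i)"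
proof -
  define n where "n = length fs"
  define A where "A = indexed_mat fs (upper_laplacian R X r)"
  define S where "S = simplices X (int r)"
  \<comment> \<open>Rows are positions in \<open>fs\<close>, matching the numbering of
    \<open>A\<close>.\<close>
  define B where "B t s = boundary_coeff R (fs ! t) s" for t s
  have fs_nth: "fs ! t \<in> simplices X (int r - 1)" if "t < n" for t
    using that assms(6) n_def nth_mem by blast
  have A_entry: "A $$ (t, u) = (\<Sum>s\<in>S. B t s * B u s)" if "t < n" "u < n" for t u
    using upper_laplacian_eq_sum [OF assms(1,2) fs_nth fs_nth] that
    by (simp add: A_def indexed_mat_def n_def S_def B_def)
  have A: "A \<in> carrier_mat n n"
    by (simp add: A_def indexed_mat_def n_def)
  have sym: "transpose_mat A = A"
    using A by (intro eq_matI) (auto simp: A_entry mult.commute)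
  obtain x where
    orth: "\<And>i j. i \<in> {1..n} \<Longrightarrow> j \<in> {1..n} \<Longrightarrow> (\<Sum>t<n. x i t * x j t) = (if i = j then 1 else (0::real))"
    and eig: "\<And>i t. i \<in> {1..n} \<Longrightarrow> t < n \<Longrightarrow> (\<Sum>u<n. A $$ (t, u) * x i u) = ith_eigenvalue A i * x i t"
    using orthonormal_eigenvectors [OF A sym] by blast
  have n_card: "n = card (simplices X (int r - 1))"
    using assms(5,6) by (metis n_def distinct_card)
  have m: "(r + 1) * k \<le> n"
  proof -
    have "real ((r + 1) * k) \<le> real n"
      using assms(8) by (simp add: n_card face_number_def field_simps)
    then show ?thesis by linarith
  qed
  then have k: "k \<le> n"
    by (metis add.commute le_trans mult_le_mono1 le_add1 nat_mult_1)
  define d where "d t = r_degree X r (fs ! t)" for t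
  have fin: "finite \<sigma>" if "\<sigma> \<in> X" for \<sigma>
    using assms(1) that unfolding simplicial_complex_def by (auto intro: finite_subset)
  have finS: "finite S"
    using assms(1) unfolding simplicial_complex_def S_def simplices_def by (auto intro: finite_subset)
  have inj: "inj_on ((!) fs) {..<n}"
    using assms(5) by (simp add: inj_on_nth n_def)
  \<comment> \<open>Nonzero entries of a column sit at distinct facets of \<open>s\<close>, and an
    \<open>r\<close>-simplex has \<open>r + 1\<close> of them.\<close>
  have col: "card {t \<in> {..<n}. B t s \<noteq> 0} \<le> r + 1" if s: "s \<in> S" for s
  proof -
    have s': "finite s" "card s = r + 1"
      using simplicesD [OF s [unfolded S_def]] fin by auto
    have "card {t \<in> {..<n}. B t s \<noteq> 0} = card ((!) fs ` {t \<in> {..<n}. B t s \<noteq> 0})"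
      using inj by (intro card_image [symmetric]) (auto simp: inj_on_def)
    also have "\<dots> \<le> card {\<tau>. \<tau> \<subseteq> s \<and> card \<tau> = r}"
    proof (rule card_mono)
      show "finite {\<tau>. \<tau> \<subseteq> s \<and> card \<tau> = r}"
        using s' by simp
      show "(!) fs ` {t \<in> {..<n}. B t s \<noteq> 0} \<subseteq> {\<tau>. \<tau> \<subseteq> s \<and> card \<tau> = r}"
      proof (rule image_subsetI)
        fix t assume t: "t \<in> {t \<in> {..<n}. B t s \<noteq> 0}"
        then have "fs ! t \<in> simplices X (int r - 1)"
          using fs_nth by simp
        then show "fs ! t \<in> {\<tau>. \<tau> \<subseteq> s \<and> card \<tau> = r}"
          using t simplicesD(2) by (fastforce simp: B_def boundary_coeff_def split: if_splits)
      qed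
    qed
    also have "\<dots> = r + 1"
      using s' by (simp add: n_subsets)
    finally show ?thesis .
  qed
  obtain w where w: "\<And>t. t \<in> {..<n} \<Longrightarrow> 0 \<le> w t" "\<And>t. t \<in> {..<n} \<Longrightarrow> w t \<le> 1"
    "sum w {..<n} \<le> real ((r + 1) * card {1..k})"
    and le: "sum (ith_eigenvalue A) {1..k} \<le> (\<Sum>t<n. real (d t) * w t)"
  proof (rule sum_eigenvalues_le_weighted_sum [of "{..<n}" S "{1..k}" x B "ith_eigenvalue A" d "r + 1"])
    show "(\<Sum>t<n. x i t * x j t) = (if i = j then 1 else 0)" if "i \<in> {1..k}" "j \<in> {1..k}" for i j
      using orth that k by simp
    show "(\<Sum>u<n. (\<Sum>s\<in>S. B t s * B u s) * x i u) = ith_eigenvalue A i * x i t"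
      if "i \<in> {1..k}" "t \<in> {..<n}" for i t
      using eig [of i t] that k by (simp add: A_entry)
    show "(\<Sum>s\<in>S. (B t s)\<^sup>2) = real (d t)" if "t \<in> {..<n}" for t
      unfolding S_def B_def d_def by (rule sum_boundary_coeff_square [OF assms(1)])
  qed (use finS col in auto)
  \<comment> \<open>As \<open>fs\<close> enumerates without repetition, degrees by position and
    degrees by simplex form the same multiset.\<close>
  have degs: "image_mset d (mset_set {..<n})
                = image_mset (r_degree X r) (mset_set (simplices X (int r - 1)))"
  proof -
    have "simplices X (int r - 1) = (!) fs ` {..<n}"
      unfolding assms(6) [symmetric] n_def set_conv_nth by auto
    then have "mset_set (simplices X (int r - 1)) = image_mset ((!) fs) (mset_set {..<n})"
      using inj by (simp add: image_mset_mset_set)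
    then show ?thesis
      by (simp add: d_def [abs_def] multiset.map_comp o_def)
  qed
  have "(\<Sum>i = 1..k. ith_eigenvalue A i) \<le> (\<Sum>t<n. real (d t) * w t)"
    using le by simp
  also have "\<dots> \<le> (\<Sum>i = 1..(r + 1) * k. real (ith_largest (image_mset d (mset_set {..<n})) i))"
    using w m by (intro sum_mult_le_sum_ith_largest) auto
  finally show ?thesis
    by (simp add: A_def ith_degree_def degs)
qed

end
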